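(* Let $G$ be a groupoid, with set of composable pairs $G^2\subset G\times G$. Then there exists an inverse semigroup $S(G)$ such that, as a set, $S(G)=G\cup\{0\}$, where $0\notin G$ is a zero element of $S(G)$, and the multiplication of $S(G)$ extends the multiplication of $G$, i.e. for every $(a,b)\in G^2$ the product of $a$ and $b$ in $S(G)$ equals their product $ab$ in $G$.
   Context: A groupoid is a set $G$ together with a subset $G^2\subset G\times G$ (the composable pairs), a product map $(a,b)\mapsto ab$ from $G^2$ to $G$, and an inverse map $a\mapsto a^{-1}$ from $G$ onto $G$ with $(a^{-1})^{-1}=a$, such that: (1) if $(a,b),(b,c)\in G^2$, then $(ab,c),(a,bc)\in G^2$ and $(ab)c=a(bc)$; (2) $(b,b^{-1})\in G^2$ for all $b\in G$, and if $(a,b)\in G^2$, then $a^{-1}(ab)=b$ and $(ab)b^{-1}=a$. An inverse semigroup is a semigroup $P$ such that for every $x\in P$ there is a unique $x^*\in P$ with $xx^*x=x$ and $x^*xx^*=x^*$. A zero element of a semigroup $P$ is an element $0\in P$ with $0x=x0=0$ for all $x\in P$. *)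

theory Defs
  imports Main
begin

text \<open>
  The operations \<open>mul\<close> and \<open>ginv\<close> are total HOL functions, but only the values of \<open>mul\<close> on the
  composable pairs \<open>G2\<close> and of \<open>ginv\<close> on \<open>G\<close> are constrained.
\<close>

locale groupoid =
  fixes G :: "'a set"
    and G2 :: "('a \<times> 'a) set"
    and mul :: "'a \<Rightarrow> 'a \<Rightarrow> 'a"
    and ginv :: "'a \<Rightarrow> 'a"
  assumes composable_subset: "G2 \<subseteq> G \<times> G"
    and mul_closed: "(a, b) \<in> G2 \<Longrightarrow> mul a b \<in> G"
    and inv_onto: "ginv ` G = G"
    and inv_inv: "a \<in> G \<Longrightarrow> ginv (ginv a) = a"
    and assoc_left_composable: "(a, b) \<in> G2 \<Longrightarrow> (b, c) \<in> G2 \<Longrightarrow> (mul a b, c) \<in> G2"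
    and assoc_right_composable: "(a, b) \<in> G2 \<Longrightarrow> (b, c) \<in> G2 \<Longrightarrow> (a, mul b c) \<in> G2"
    and assoc: "(a, b) \<in> G2 \<Longrightarrow> (b, c) \<in> G2 \<Longrightarrow> mul (mul a b) c = mul a (mul b c)"
    and inv_composable: "b \<in> G \<Longrightarrow> (b, ginv b) \<in> G2"
    and inv_cancel_left: "(a, b) \<in> G2 \<Longrightarrow> mul (ginv a) (mul a b) = b"
    and inv_cancel_right: "(a, b) \<in> G2 \<Longrightarrow> mul (mul a b) (ginv b) = a"

text \<open>
  Semigroups are given by an explicit carrier set, since the type class and the locale
  \<^locale>\<open>semigroup\<close> of HOL require the operation to be associative on a whole type.
\<close>

locale semigroup_on =
  fixes P :: "'a set"
    and smul :: "'a \<Rightarrow> 'a \<Rightarrow> 'a"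
  assumes closed: "x \<in> P \<Longrightarrow> y \<in> P \<Longrightarrow> smul x y \<in> P"
    and assoc: "x \<in> P \<Longrightarrow> y \<in> P \<Longrightarrow> z \<in> P \<Longrightarrow> smul (smul x y) z = smul x (smul y z)"

locale inverse_semigroup_on = semigroup_on P smul
  for P :: "'a set"
    and smul :: "'a \<Rightarrow> 'a \<Rightarrow> 'a" +
  assumes ex1_inverse: "x \<in> P \<Longrightarrow>
    \<exists>!y. y \<in> P \<and> smul (smul x y) x = x \<and> smul (smul y x) y = y"

definition zero_element_on :: "'a set \<Rightarrow> ('a \<Rightarrow> 'a \<Rightarrow> 'a) \<Rightarrow> 'a \<Rightarrow> bool" where
  "zero_element_on P smul z \<longleftrightarrow> z \<in> P \<and> (\<forall>x\<in>P. smul z x = z \<and> smul x z = z)"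

text \<open>
  The disjoint union of \<open>G\<close> with one new point \<open>0\<close>: an element \<open>a\<close> of \<open>G\<close> is identified with
  \<^term>\<open>Some a\<close>, and \<open>0\<close> is \<^term>\<open>None\<close>. A new type is needed because \<open>G\<close> may exhaust its type.
\<close>

definition adjoin_zero :: "'a set \<Rightarrow> 'a option set" where
  "adjoin_zero G = Some ` G \<union> {None}"

end

theory Submission
  imports Defs
begin

text \<open>
  Products of non-composable elements are set to \<open>0\<close>. Associativity then needs that \<open>(ab)c\<close> is defined
  exactly when \<open>a(bc)\<close> is: by cancellation \<open>b = a\<^sup>-\<^sup>1(ab)\<close>, so composability of \<open>ab\<close> with \<open>c\<close> yields
  that of \<open>b\<close> with \<open>c\<close>, and symmetrically. An inverse \<open>y\<close> of \<open>x \<noteq> 0\<close> satisfies \<open>(xy)x = x \<noteq> 0\<close>;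
  cancelling \<open>x\<close> gives \<open>xy = xx\<^sup>-\<^sup>1\<close> and hence \<open>y = x\<^sup>-\<^sup>1\<close>.
\<close>

context groupoid
begin

lemma ginv_closed: "a \<in> G \<Longrightarrow> ginv a \<in> G"
  using inv_onto by blast

lemma composable_carrier:
  assumes "(a, b) \<in> G2"
  shows "a \<in> G" "b \<in> G"
  using assms composable_subset by auto

lemma ginv_composable: "a \<in> G \<Longrightarrow> (ginv a, a) \<in> G2"
  using inv_composable[of "ginv a"] by (simp add: ginv_closed inv_inv)

lemma composable_mul_left_iff:
  assumes "(a, b) \<in> G2"
  shows "(mul a b, c) \<in> G2 \<longleftrightarrow> (b, c) \<in> G2"
proof
  assume "(mul a b, c) \<in> G2"
  \<comment> \<open>Axiom (1) applied to the composable pairs \<open>(ginv a, a)\<close> and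
    \<open>(a, b)\<close>.\<close>
  moreover have "(ginv a, mul a b) \<in> G2"
    using assms by (meson assoc_right_composable composable_carrier(1) ginv_composable)
  ultimately have "(mul (ginv a) (mul a b), c) \<in> G2"
    by (rule assoc_left_composable[rotated])
  then show "(b, c) \<in> G2"
    by (simp add: inv_cancel_left assms)
qed (use assms assoc_left_composable in blast)

lemma composable_mul_right_iff:
  assumes "(b, c) \<in> G2"
  shows "(a, mul b c) \<in> G2 \<longleftrightarrow> (a, b) \<in> G2"
proof
  assume "(a, mul b c) \<in> G2"
  moreover have "(mul b c, ginv c) \<in> G2"
    using assms by (meson assoc_left_composable composable_carrier(2) inv_composable)
  ultimately have "(a, mul (mul b c) (ginv c)) \<in> G2"
    by (rule assoc_right_composable)
  then show "(a, b) \<in> G2"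
    by (simp add: inv_cancel_right assms)
qed (use assms assoc_right_composable in blast)

lemma mul_ginv_mul: "x \<in> G \<Longrightarrow> mul (mul x (ginv x)) x = x"
  using inv_cancel_right[OF inv_composable] by (simp add: inv_inv)

lemma ginv_unique:
  assumes "(x, y) \<in> G2" and "(mul x y, x) \<in> G2" and "mul (mul x y) x = x"
  shows "y = ginv x"
proof -
  have "x \<in> G"
    using assms(1) by (rule composable_carrier)
  \<comment> \<open>Right cancellation in \<open>((xy)x) x^{-1} = xy\<close>, where
    \<open>(xy)x\<close> is \<open>x\<close>.\<close>
  have "mul x y = mul x (ginv x)"
    using inv_cancel_right[OF assms(2)] assms(3) by simp
  then have "y = mul (ginv x) (mul x (ginv x))"
    using inv_cancel_left[OF assms(1)] by simp
  also have "\<dots> = ginv x"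
    using \<open>x \<in> G\<close> by (intro inv_cancel_left inv_composable)
  finally show ?thesis .
qed

fun zmul :: "'a option \<Rightarrow> 'a option \<Rightarrow> 'a option" where
  "zmul (Some a) (Some b) = (if (a, b) \<in> G2 then Some (mul a b) else None)"
| "zmul _ _ = None"

lemma zmul_None_right [simp]: "zmul x None = None"
  by (cases x) simp_all

lemma zmul_closed: "zmul x y \<in> adjoin_zero G"
  by (cases "(x, y)" rule: zmul.cases) (auto simp: adjoin_zero_def mul_closed)

text \<open>For nonzero factors \<open>a\<close>, \<open>b\<close>, \<open>c\<close>, either
  bracketing is nonzero exactly when \<open>(a, b)\<close> and \<open>(b, c)\<close> both lie in
  \<open>G2\<close>.\<close>

lemma zmul_assoc: "zmul (zmul x y) z = zmul x (zmul y z)"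
  by (cases x; cases y; cases z)
    (auto simp: composable_mul_left_iff composable_mul_right_iff assoc)

lemma zmul_ginv_zmul:
  "x \<in> G \<Longrightarrow> zmul (zmul (Some x) (Some (ginv x))) (Some x) = Some x"
  using composable_mul_left_iff[OF inv_composable]
  by (simp add: inv_composable ginv_composable mul_ginv_mul)

text \<open>The nonzero result forces \<open>y\<close> to be nonzero and both products to be
  composable, as \<open>ginv_unique\<close> requires.\<close>

lemma zmul_inverse_unique:
  assumes "zmul (zmul (Some x) y) (Some x) = Some x"
  shows "y = Some (ginv x)"
  using assms by (cases y) (auto split: if_splits intro: ginv_unique)

lemma inverse_semigroup_zmul: "inverse_semigroup_on (adjoin_zero G) zmul"
proof
  fix x
  assume "x \<in> adjoin_zero G"
  then consider "x = None" | a where "x = Some a" "a \<in> G"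
    by (auto simp: adjoin_zero_def)
  then show "\<exists>!y. y \<in> adjoin_zero G \<and> zmul (zmul x y) x = x \<and> zmul (zmul y x) y = y"
  proof cases
    case 1
    \<comment> \<open>Any inverse \<open>y\<close> of \<open>0\<close> satisfies
      \<open>y = (y0)y = 0\<close>.\<close>
    then show ?thesis
      by (auto simp: adjoin_zero_def)
  next
    case 2
    then have "Some (ginv a) \<in> adjoin_zero G"
      by (simp add: adjoin_zero_def ginv_closed)
    \<comment> \<open>The second inverse law for \<open>a\<close> is the first one for
      \<open>ginv a\<close>, whose inverse is \<open>a\<close>.\<close>
    moreover have "zmul (zmul (Some (ginv a)) (Some a)) (Some (ginv a)) = Some (ginv a)"
      using zmul_ginv_zmul[of "ginv a"] 2 by (simp only: ginv_closed inv_inv)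
    ultimately show ?thesis
      using 2 zmul_ginv_zmul zmul_inverse_unique by blast
  qed
qed (simp_all add: zmul_closed zmul_assoc)

end

theorem lemma1p4:
  fixes G :: "'a set"
    and G2 :: "('a \<times> 'a) set"
    and mul :: "'a \<Rightarrow> 'a \<Rightarrow> 'a"
    and ginv :: "'a \<Rightarrow> 'a"
  assumes "groupoid G G2 mul ginv"
  shows "\<exists>smul :: 'a option \<Rightarrow> 'a option \<Rightarrow> 'a option.
    inverse_semigroup_on (adjoin_zero G) smul \<and>
    zero_element_on (adjoin_zero G) smul None \<and>
    (\<forall>a b. (a, b) \<in> G2 \<longrightarrow> smul (Some a) (Some b) = Some (mul a b))"
proof -
  interpret groupoid G G2 mul ginv
    by (rule assms)
  show ?thesis
    using inverse_semigroup_zmul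
    by (intro exI[of _ zmul]) (simp add: zero_element_on_def adjoin_zero_def)
qed

end
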